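(* Let $X$ be a Banach space, $m$ a positive integer, and $T\in X\otimes\ell_2^m$. Suppose that $T^*$ is 2-summing and $\mathrm{rank}(T)\le r$. Then $$\|T\|\le\pi_2(T^* )\le\sqrt r\,\|T\|.$$
   Context: An element $T=\sum_kx_k\otimes y_k\in X\otimes Y$ is viewed as the linear operator $X^*\to Y$, $x^*\mapsto\sum_kx^*(x_k)y_k$; $\|T\|$ is its operator norm and $T^*$ is its adjoint, which acts as $y^*\mapsto\sum_ky^*(y_k)x_k$ from $Y^*$ to $X$. For a linear operator $S:E\to F$ between Banach spaces, the 2-summing norm $\pi_2(S)$ is the smallest $c>0$ such that $\sum_k\|Sz_k\|_F^2\le c^2\sup_{z^*\in B_{E^*}}\sum_k|z^*(z_k)|^2$ for all finite sequences $(z_k)\subset E$; $S$ is 2-summing if $\pi_2(S)<\infty$. *)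

theory Defs
  imports "HOL-Analysis.Analysis"
begin

text \<open>
  The scalar field is the real or the complex field. Both cases are treated at once by a type class
  of normed fields that are isometrically isomorphic to one of the two.
\<close>

class real_or_complex = real_normed_field +
  assumes real_or_complex:
    "\<exists>h :: 'a \<Rightarrow> complex. (\<forall>a b. h (a + b) = h a + h b) \<and> (\<forall>t a. h (t *\<^sub>R a) = t *\<^sub>R h a) \<and>
       h 1 = 1 \<and> (\<forall>a b. h (a * b) = h a * h b) \<and>
       (\<forall>a. norm (h a) = norm a) \<and> (range h = \<real> \<or> range h = UNIV)"

instance real :: real_or_complex
proof
  show "\<exists>h :: real \<Rightarrow> complex. (\<forall>a b. h (a + b) = h a + h b) \<and> (\<forall>t a. h (t *\<^sub>R a) = t *\<^sub>R h a) \<and>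
       h 1 = 1 \<and> (\<forall>a b. h (a * b) = h a * h b) \<and>
       (\<forall>a. norm (h a) = norm a) \<and> (range h = \<real> \<or> range h = UNIV)"
    by (intro exI[of _ complex_of_real]) (auto simp: Reals_def scaleR_conv_of_real)
qed

instance complex :: real_or_complex
proof
  show "\<exists>h :: complex \<Rightarrow> complex. (\<forall>a b. h (a + b) = h a + h b) \<and> (\<forall>t a. h (t *\<^sub>R a) = t *\<^sub>R h a) \<and>
       h 1 = 1 \<and> (\<forall>a b. h (a * b) = h a * h b) \<and>
       (\<forall>a. norm (h a) = norm a) \<and> (range h = \<real> \<or> range h = UNIV)"
    by (intro exI[of _ "\<lambda>z. z"]) auto
qed

text \<open>
  A normed space over \<open>'k\<close> is a real normed space together with a scalar multiplication by
  elements of \<open>'k\<close> that extends the real one; it is a Banach space if its type is of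
  class \<open>banach\<close>.
\<close>

locale normed_space_over = vector_space smul
  for smul :: "'k::real_or_complex \<Rightarrow> 'a::real_normed_vector \<Rightarrow> 'a" +
  assumes norm_smul: "norm (smul c x) = norm c * norm x"
    and smul_of_real: "smul (of_real a) x = a *\<^sub>R x"

lemma normed_space_over_scaleR:
  "normed_space_over (scaleR :: real \<Rightarrow> 'a::real_normed_vector \<Rightarrow> 'a)"
  by unfold_locales (auto simp: algebra_simps)

lemma normed_space_over_vec:
  "normed_space_over ((*s) :: 'k::real_or_complex \<Rightarrow> 'k ^ 'm \<Rightarrow> 'k ^ 'm)"
proof (intro normed_space_over.intro normed_space_over_axioms.intro)
  show "vector_space ((*s) :: 'k \<Rightarrow> 'k ^ 'm \<Rightarrow> 'k ^ 'm)"
    by (rule vec.vector_space_axioms)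
  fix c :: 'k and x :: "'k ^ 'm" and a :: real
  show "norm (c *s x) = norm c * norm x"
    by (simp add: norm_vec_def norm_mult L2_set_right_distrib)
  show "of_real a *s x = a *\<^sub>R x"
    by (simp add: vec_eq_iff scaleR_conv_of_real[where 'a='k])
qed

text \<open>
  The dual space over \<open>'k\<close>. Its elements are collected inside the type of bounded real-linear maps
  into \<open>'k\<close>, whose norm is the operator norm. The dual of a type is therefore a subset of a type,
  and the notions below refer to an explicit domain \<open>E\<close>.
\<close>

definition dual_space ::
  "('k::real_or_complex \<Rightarrow> 'a::real_normed_vector \<Rightarrow> 'a) \<Rightarrow> ('a \<Rightarrow>\<^sub>L 'k) set" where
  "dual_space smul = {f. \<forall>c x. blinfun_apply f (smul c x) = c * blinfun_apply f x}"

definition dual_smul ::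
  "'k::real_or_complex \<Rightarrow> ('a::real_normed_vector \<Rightarrow>\<^sub>L 'k) \<Rightarrow> ('a \<Rightarrow>\<^sub>L 'k)" where
  "dual_smul c f = blinfun_mult_right c o\<^sub>L f"

lemma dual_smul_apply: "blinfun_apply (dual_smul c f) x = c * blinfun_apply f x"
  by (simp add: dual_smul_def)

lemma dual_space_scaleR: "dual_space (scaleR :: real \<Rightarrow> 'a::real_normed_vector \<Rightarrow> 'a) = UNIV"
  by (auto simp: dual_space_def blinfun.scaleR_right)

text \<open>
  The closed unit ball of the dual of a normed space with underlying set \<open>E\<close>. Only the values on
  \<open>E\<close> are relevant.
\<close>

definition dual_unit_ball ::
  "('k::real_or_complex \<Rightarrow> 'e::real_normed_vector \<Rightarrow> 'e) \<Rightarrow> 'e set \<Rightarrow> ('e \<Rightarrow> 'k) set" where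
  "dual_unit_ball smul E =
     {\<phi>. (\<forall>u\<in>E. \<forall>v\<in>E. \<phi> (u + v) = \<phi> u + \<phi> v) \<and> (\<forall>c. \<forall>u\<in>E. \<phi> (smul c u) = c * \<phi> u) \<and>
         (\<forall>u\<in>E. norm (\<phi> u) \<le> norm u)}"

definition operator_norm_on ::
  "'e::real_normed_vector set \<Rightarrow> ('e \<Rightarrow> 'f::real_normed_vector) \<Rightarrow> real" where
  "operator_norm_on E S = (SUP u\<in>{u\<in>E. norm u \<le> 1}. norm (S u))"

text \<open>
  The infimum replaces ``the smallest \<open>c > 0\<close>'' in order to cover \<open>S = 0\<close>; it is \<open>\<infinity>\<close> if there is no
  admissible \<open>c\<close>.
\<close>

definition pi2 ::
  "('k::real_or_complex \<Rightarrow> 'e::real_normed_vector \<Rightarrow> 'e) \<Rightarrow> 'e set \<Rightarrow>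
   ('e \<Rightarrow> 'f::real_normed_vector) \<Rightarrow> ereal" where
  "pi2 smul E S =
     (INF c\<in>{c::real. c > 0 \<and>
        (\<forall>zs. set zs \<subseteq> E \<longrightarrow>
           (\<Sum>z\<leftarrow>zs. (norm (S z))\<^sup>2)
             \<le> c\<^sup>2 * (SUP \<phi>\<in>dual_unit_ball smul E. \<Sum>z\<leftarrow>zs. (norm (\<phi> z))\<^sup>2))}. ereal c)"

definition two_summing ::
  "('k::real_or_complex \<Rightarrow> 'e::real_normed_vector \<Rightarrow> 'e) \<Rightarrow> 'e set \<Rightarrow>
   ('e \<Rightarrow> 'f::real_normed_vector) \<Rightarrow> bool" where
  "two_summing smul E S \<longleftrightarrow> pi2 smul E S < \<infinity>"

text \<open>
  A list of pairs \<open>(x\<^sub>k, y\<^sub>k)\<close> represents the element \<open>\<Sum>\<^sub>k x\<^sub>k \<otimes> y\<^sub>k\<close> of the algebraic tensor product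
  \<open>X \<otimes> Y\<close>. The following are the associated operator from the dual of \<open>X\<close> to \<open>Y\<close> and its adjoint
  from the dual of \<open>Y\<close> to \<open>X\<close>.
\<close>

definition tensor_op ::
  "('k::real_or_complex \<Rightarrow> 'y::real_normed_vector \<Rightarrow> 'y) \<Rightarrow> ('x::real_normed_vector \<times> 'y) list \<Rightarrow>
   ('x \<Rightarrow>\<^sub>L 'k) \<Rightarrow> 'y" where
  "tensor_op smulY ts f = (\<Sum>(x, y)\<leftarrow>ts. smulY (blinfun_apply f x) y)"

definition tensor_adjoint ::
  "('k::real_or_complex \<Rightarrow> 'x::real_normed_vector \<Rightarrow> 'x) \<Rightarrow> ('x \<times> 'y::real_normed_vector) list \<Rightarrow>
   ('y \<Rightarrow>\<^sub>L 'k) \<Rightarrow> 'x" where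
  "tensor_adjoint smulX ts g = (\<Sum>(x, y)\<leftarrow>ts. smulX (blinfun_apply g y) x)"

end

theory Submission
  imports Defs
begin

text \<open>
  Both estimates rest on the duality \<open>f (T\<^sup>* g) = g (T f)\<close> (\<open>tensor_adjoint_duality\<close>).

  Lower bound. For \<open>f\<close> in the unit ball of \<open>X\<^sup>*\<close> put \<open>w = T f\<close> and test the 2-summing inequality on
  the single functional \<open>g = \<langle>\<cdot>, w\<rangle>\<close>. Since \<open>\<parallel>g\<parallel> \<le> \<parallel>w\<parallel>\<close>, every admissible constant \<open>c\<close> satisfies
  \<open>\<parallel>w\<parallel>\<^sup>2 = g (T f) = f (T\<^sup>* g) \<le> \<parallel>T\<^sup>* g\<parallel> \<le> c \<parallel>w\<parallel>\<close>, so \<open>\<parallel>T f\<parallel> \<le> c\<close>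
  (\<open>operator_norm_le_2_summing_constant\<close>).

  Upper bound. Choose an orthonormal family \<open>C\<close> with at most \<open>r\<close> elements whose span contains the
  range of \<open>T\<close>. By the Hahn-Banach theorem each \<open>T\<^sup>* g\<close> has a norming functional \<open>f\<close>, and expanding
  \<open>T f\<close> in \<open>C\<close> gives
  \<open>\<parallel>T\<^sup>* g\<parallel> \<le> \<bar>g (T f)\<bar> \<le> \<parallel>T\<parallel> (\<Sum>\<^sub>e \<bar>g e\<bar>\<^sup>2)\<^sup>1\<^sup>/\<^sup>2\<close> by the Cauchy-Schwarz inequality
  (\<open>tensor_adjoint_norm_le_orthonormal\<close>). So \<open>\<parallel>T\<^sup>* g\<parallel>\<close> is controlled by the values
  of \<open>g\<close> on \<open>C\<close>, as for a Hilbert-Schmidt operator. Squaring, summing over a finite family of \<open>g\<close>'s and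
  exchanging the two sums leaves at most \<open>r\<close> terms \<open>\<Sum>\<^sub>g \<bar>g e\<bar>\<^sup>2\<close>, and evaluation at a unit vector \<open>e\<close>
  is one of the functionals over which the supremum in the definition of the 2-summing norm is taken
  (\<open>sqrt_rank_2_summing_constant\<close>).

  The norming functional is obtained from the real Hahn-Banach theorem, in the form that minimal
  sublinear functionals are linear, followed by the recovery of a scalar-valued functional from its
  real part.
\<close>

section \<open>The Hahn-Banach theorem for sublinear functionals\<close>

definition sublinear :: "('a::real_vector \<Rightarrow> real) \<Rightarrow> bool" where
  "sublinear p \<longleftrightarrow> (\<forall>x y. p (x + y) \<le> p x + p y) \<and> (\<forall>x. \<forall>a\<ge>0. p (a *\<^sub>R x) = a * p x)"

lemma sublinear_add: "sublinear p \<Longrightarrow> p (x + y) \<le> p x + p y"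
  by (simp add: sublinear_def)

lemma sublinear_scaleR: "sublinear p \<Longrightarrow> a \<ge> 0 \<Longrightarrow> p (a *\<^sub>R x) = a * p x"
  by (simp add: sublinear_def)

lemma sublinear_0: "sublinear p \<Longrightarrow> p 0 = 0"
  using sublinear_scaleR[of p 0 0] by simp

lemma sublinear_minus: "sublinear p \<Longrightarrow> - p (- x) \<le> p x"
  using sublinear_add[of p x "- x"] sublinear_0[of p] by simp

text \<open>
  For positive factors an inequality suffices, since it can be applied to the inverse factor too. This
  suits functionals defined as infima, where only one inequality is immediate.
\<close>

lemma sublinearI:
  assumes add: "\<And>x y. p (x + y) \<le> p x + p y"
    and zero: "p 0 = 0"
    and scale: "\<And>a x. a > 0 \<Longrightarrow> p (a *\<^sub>R x) \<le> a * p x"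
  shows "sublinear p"
  unfolding sublinear_def
proof (intro conjI allI impI)
  fix x y :: 'a and a :: real
  show "p (x + y) \<le> p x + p y" by (rule add)
  assume "a \<ge> 0"
  show "p (a *\<^sub>R x) = a * p x"
  proof (cases "a = 0")
    case True
    then show ?thesis by (simp add: zero)
  next
    case False
    with \<open>a \<ge> 0\<close> have a: "a > 0" by simp
    have "p x \<le> (1 / a) * p (a *\<^sub>R x)"
      using scale[of "1 / a" "a *\<^sub>R x"] a by simp
    then have "a * p x \<le> p (a *\<^sub>R x)"
      using a by (simp add: field_simps)
    then show ?thesis using scale[OF a, of x] by simp
  qed
qed

lemma sublinear_norm: "sublinear (norm :: 'a::real_normed_vector \<Rightarrow> real)"
  by (auto simp: sublinear_def norm_triangle_ineq)

text \<open>
  The largest sublinear functional below \<open>p\<close> whose value at \<open>- y\<close> is at most \<open>- p y\<close>, that is, which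
  is linear along the line spanned by \<open>y\<close> with slope \<open>p y\<close>.
\<close>

definition lower_along :: "'a::real_vector \<Rightarrow> ('a \<Rightarrow> real) \<Rightarrow> 'a \<Rightarrow> real" where
  "lower_along y p x = (INF t\<in>{0..}. p (x + t *\<^sub>R y) - t * p y)"

text \<open>
  The infimum is bounded below because \<open>t p y = p (t y) \<le> p (x + t y) + p (- x)\<close>.
\<close>

lemma lower_along_le:
  assumes "sublinear p" and "t \<ge> 0"
  shows "lower_along y p x \<le> p (x + t *\<^sub>R y) - t * p y"
  unfolding lower_along_def
proof (rule cINF_lower)
  show "bdd_below ((\<lambda>t. p (x + t *\<^sub>R y) - t * p y) ` {0..})"
  proof (rule bdd_belowI2)
    fix s :: real assume "s \<in> {0..}"
    then have "s * p y = p ((x + s *\<^sub>R y) + - x)"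
      using sublinear_scaleR[OF assms(1), of s y] by simp
    also have "\<dots> \<le> p (x + s *\<^sub>R y) + p (- x)"
      by (rule sublinear_add[OF assms(1)])
    finally show "- p (- x) \<le> p (x + s *\<^sub>R y) - s * p y" by simp
  qed
  show "t \<in> {0..}" using assms(2) by simp
qed

lemma sublinear_lower_along:
  assumes p: "sublinear p"
  shows "sublinear (lower_along y p)"
proof (rule sublinearI)
  fix x1 x2
  have "lower_along y p (x1 + x2) - (p (x2 + t *\<^sub>R y) - t * p y) \<le> lower_along y p x1"
    if t: "t \<ge> 0" for t
    unfolding lower_along_def[of y p x1]
  proof (rule cINF_greatest)
    fix s :: real assume "s \<in> {0..}"
    then have "lower_along y p (x1 + x2) \<le> p (x1 + x2 + (s + t) *\<^sub>R y) - (s + t) * p y"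
      using lower_along_le[OF p, of "s + t"] t by simp
    also have "p (x1 + x2 + (s + t) *\<^sub>R y) \<le> p (x1 + s *\<^sub>R y) + p (x2 + t *\<^sub>R y)"
      using sublinear_add[OF p, of "x1 + s *\<^sub>R y" "x2 + t *\<^sub>R y"] by (simp add: algebra_simps)
    finally show "lower_along y p (x1 + x2) - (p (x2 + t *\<^sub>R y) - t * p y)
        \<le> p (x1 + s *\<^sub>R y) - s * p y"
      by (simp add: algebra_simps)
  qed simp
  then have "lower_along y p (x1 + x2) - lower_along y p x1 \<le> p (x2 + t *\<^sub>R y) - t * p y"
    if "t \<ge> 0" for t
    using that by (simp add: algebra_simps)
  then have "lower_along y p (x1 + x2) - lower_along y p x1 \<le> lower_along y p x2"
    unfolding lower_along_def[of y p x2] by (intro cINF_greatest) auto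
  then show "lower_along y p (x1 + x2) \<le> lower_along y p x1 + lower_along y p x2" by simp
next
  have "(\<lambda>t. p (0 + t *\<^sub>R y) - t * p y) ` {0..} = {0}"
    using sublinear_scaleR[OF p] by (auto simp: image_iff intro!: exI[of _ 0])
  then show "lower_along y p 0 = 0" by (simp only: lower_along_def) simp
next
  fix a :: real and x assume a: "a > 0"
  have "lower_along y p (a *\<^sub>R x) / a \<le> lower_along y p x"
    unfolding lower_along_def[of y p x]
  proof (rule cINF_greatest)
    fix t :: real assume t: "t \<in> {0..}"
    then have "lower_along y p (a *\<^sub>R x) \<le> p (a *\<^sub>R x + (a * t) *\<^sub>R y) - (a * t) * p y"
      using lower_along_le[OF p, of "a * t"] a by simp
    also have "\<dots> = a * (p (x + t *\<^sub>R y) - t * p y)"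
      using sublinear_scaleR[OF p, of a "x + t *\<^sub>R y"] a by (simp add: algebra_simps)
    finally show "lower_along y p (a *\<^sub>R x) / a \<le> p (x + t *\<^sub>R y) - t * p y"
      using a by (simp add: field_simps)
  qed simp
  then show "lower_along y p (a *\<^sub>R x) \<le> a * lower_along y p x"
    using a by (simp add: field_simps)
qed

text \<open>
  For subadditivity two members \<open>q\<close> and \<open>q'\<close> have to be compared with a common smaller one, which is
  where the chain condition enters.
\<close>

lemma sublinear_Inf_chain:
  assumes "C \<noteq> {}"
    and C: "\<And>q. q \<in> C \<Longrightarrow> sublinear q \<and> q \<le> p"
    and chain: "\<And>q q'. q \<in> C \<Longrightarrow> q' \<in> C \<Longrightarrow> q \<le> q' \<or> q' \<le> q"
  defines "m \<equiv> \<lambda>x. INF q\<in>C. q x"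
  shows "sublinear m" and "\<And>q. q \<in> C \<Longrightarrow> m \<le> q"
proof -
  have bdd: "bdd_below ((\<lambda>q. q x) ` C)" for x
  proof (rule bdd_belowI2)
    fix q assume "q \<in> C"
    then have "q (- x) \<le> p (- x)" "- q (- x) \<le> q x"
      using C sublinear_minus by (auto simp: le_fun_def)
    then show "- p (- x) \<le> q x" by simp
  qed
  have m_le: "m x \<le> q x" if "q \<in> C" for q x
    unfolding m_def by (rule cINF_lower[OF bdd that])
  then show "\<And>q. q \<in> C \<Longrightarrow> m \<le> q" by (simp add: le_fun_def)
  have m_greatest: "b \<le> m x" if "\<And>q. q \<in> C \<Longrightarrow> b \<le> q x" for b x
    unfolding m_def by (rule cINF_greatest[OF \<open>C \<noteq> {}\<close> that])
  show "sublinear m"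
  proof (rule sublinearI)
    fix x y
    have sum: "m (x + y) \<le> q x + q' y" if qs: "q \<in> C" "q' \<in> C" for q q'
    proof -
      obtain q0 where q0: "q0 \<in> C" "q0 \<le> q" "q0 \<le> q'"
        using chain[OF qs] qs by auto
      then have "m (x + y) \<le> q0 x + q0 y"
        using m_le[of q0 "x + y"] sublinear_add[of q0 x y] C by fastforce
      with q0 show ?thesis by (meson add_mono le_funD order_trans)
    qed
    have "m (x + y) - q' y \<le> m x" if "q' \<in> C" for q'
      using sum that by (intro m_greatest) (auto simp: algebra_simps)
    then have "m (x + y) - m x \<le> m y"
      by (intro m_greatest) (auto simp: algebra_simps)
    then show "m (x + y) \<le> m x + m y" by simp
  next
    have "(\<lambda>q. q 0) ` C = {0}"
      using C \<open>C \<noteq> {}\<close> sublinear_0 by (auto simp: image_iff)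
    then show "m 0 = 0" by (simp add: m_def)
  next
    fix a :: real and x assume a: "a > 0"
    have "m (a *\<^sub>R x) / a \<le> m x"
    proof (rule m_greatest)
      fix q assume "q \<in> C"
      then have "m (a *\<^sub>R x) \<le> a * q x"
        using m_le[of q "a *\<^sub>R x"] sublinear_scaleR[of q a x] C a by simp
      then show "m (a *\<^sub>R x) / a \<le> q x" using a by (simp add: field_simps)
    qed
    then show "m (a *\<^sub>R x) \<le> a * m x" using a by (simp add: field_simps)
  qed
qed

lemma minimal_sublinear_exists:
  assumes "sublinear p"
  obtains q where "sublinear q" "q \<le> p" "\<And>q'. sublinear q' \<Longrightarrow> q' \<le> q \<Longrightarrow> q' = q"
proof -
  let ?A = "{q. sublinear q \<and> q \<le> p}"
  have "\<exists>q\<in>?A. \<forall>q'\<in>?A. q \<ge> q' \<longrightarrow> q' = q"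
  proof (rule predicate_Zorn)
    show "partial_order_on ?A (relation_of (\<ge>) ?A)"
      by (rule partial_order_on_relation_ofI) auto
    fix C assume C: "C \<in> Chains (relation_of (\<ge>) ?A)"
    then have sub: "\<And>q. q \<in> C \<Longrightarrow> sublinear q \<and> q \<le> p"
      and chain: "\<And>q q'. q \<in> C \<Longrightarrow> q' \<in> C \<Longrightarrow> q \<le> q' \<or> q' \<le> q"
      by (auto simp: Chains_def relation_of_def)
    show "\<exists>u\<in>?A. \<forall>q\<in>C. q \<ge> u"
    proof (cases "C = {}")
      case True
      then show ?thesis using assms by auto
    next
      case False
      then obtain q0 where "q0 \<in> C" by auto
      have "sublinear (\<lambda>x. INF q\<in>C. q x)" and le: "\<And>q. q \<in> C \<Longrightarrow> (\<lambda>x. INF q\<in>C. q x) \<le> q"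
        using sublinear_Inf_chain[OF False sub chain] by blast+
      moreover have "(\<lambda>x. INF q\<in>C. q x) \<le> p"
        using le[OF \<open>q0 \<in> C\<close>] sub[OF \<open>q0 \<in> C\<close>] by (meson order_trans)
      ultimately show ?thesis by blast
    qed
  qed
  then obtain q where "sublinear q" "q \<le> p"
    and "\<And>q'. sublinear q' \<Longrightarrow> q' \<le> p \<Longrightarrow> q' \<le> q \<Longrightarrow> q' = q"
    by blast
  then show thesis using that[of q] order_trans by blast
qed

lemma lower_along_le_self: "sublinear p \<Longrightarrow> lower_along y p \<le> p"
  using lower_along_le[of p 0 y] by (simp add: le_fun_def)

text \<open>
  Making \<open>q\<close> linear along \<open>y\<close> cannot lower it any more, so \<open>q x \<le> q (x + y) - q y\<close>: the reverse of
  subadditivity.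
\<close>

lemma minimal_sublinear_linear:
  assumes q: "sublinear q" and min: "\<And>q'. sublinear q' \<Longrightarrow> q' \<le> q \<Longrightarrow> q' = q"
  shows "linear q"
proof -
  have add: "q (x + y) = q x + q y" for x y
  proof (rule antisym)
    have "lower_along y q = q"
      by (rule min[OF sublinear_lower_along[OF q] lower_along_le_self[OF q]])
    then show "q x + q y \<le> q (x + y)"
      using lower_along_le[OF q, of 1 y x] by simp
  qed (rule sublinear_add[OF q])
  have neg: "q (- x) = - q x" for x
    using add[of x "- x"] sublinear_0[OF q] by simp
  have "q (a *\<^sub>R x) = a * q x" for a x
  proof (cases "a \<ge> 0")
    case False
    then show ?thesis
      using sublinear_scaleR[OF q, of "- a" x] neg[of "a *\<^sub>R x"] by simp
  qed (rule sublinear_scaleR[OF q])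
  with add show ?thesis by (intro linearI) auto
qed

text \<open>
  A minimal functional below \<open>lower_along x0 p\<close> is linear, and at \<open>- x0\<close> it is at most \<open>- p x0\<close>, which
  forces equality with \<open>p\<close> at \<open>x0\<close>.
\<close>

lemma Hahn_Banach_sublinear:
  assumes p: "sublinear p"
  obtains u where "linear u" "\<And>x. u x \<le> p x" "u x0 = p x0"
proof -
  obtain u where u: "sublinear u" "u \<le> lower_along x0 p"
    and min: "\<And>q'. sublinear q' \<Longrightarrow> q' \<le> u \<Longrightarrow> q' = u"
    using minimal_sublinear_exists[OF sublinear_lower_along[OF p]] by metis
  have lin: "linear u" by (rule minimal_sublinear_linear[OF u(1) min])
  have le: "u x \<le> p x" for x
    using u(2) lower_along_le_self[OF p, of x0] by (meson le_funD order_trans)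
  have "u (- x0) \<le> - p x0"
    using u(2) lower_along_le[OF p, of 1 x0 "- x0"] sublinear_0[OF p]
    by (force simp: le_fun_def intro: order_trans)
  then have "p x0 \<le> u x0" using linear_neg[OF lin] by simp
  then have "u x0 = p x0" using le[of x0] by simp
  with lin le show thesis by (rule that)
qed

section \<open>Scalars and conjugation\<close>

definition to_complex :: "'k::real_or_complex \<Rightarrow> complex" where
  "to_complex = (SOME h. (\<forall>a b. h (a + b) = h a + h b) \<and> (\<forall>t a. h (t *\<^sub>R a) = t *\<^sub>R h a) \<and>
     h 1 = 1 \<and> (\<forall>a b. h (a * b) = h a * h b) \<and>
     (\<forall>a. norm (h a) = norm a) \<and> (range h = \<real> \<or> range h = UNIV))"

lemma
  fixes a b :: "'k::real_or_complex"
  shows to_complex_add: "to_complex (a + b) = to_complex a + to_complex b"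
    and to_complex_scaleR: "to_complex (t *\<^sub>R a) = t *\<^sub>R to_complex a"
    and to_complex_1: "to_complex (1::'k) = 1"
    and to_complex_mult: "to_complex (a * b) = to_complex a * to_complex b"
    and norm_to_complex: "norm (to_complex a) = norm a"
    and range_to_complex: "range (to_complex :: 'k \<Rightarrow> complex) = \<real> \<or> range (to_complex :: 'k \<Rightarrow> complex) = UNIV"
proof -
  note spec = someI_ex[OF real_or_complex[where 'a='k], folded to_complex_def]
  show "to_complex (a + b) = to_complex a + to_complex b" using spec by (elim conjE) simp
  show "to_complex (t *\<^sub>R a) = t *\<^sub>R to_complex a" using spec by (elim conjE) simp
  show "to_complex (1::'k) = 1" using spec by (elim conjE) assumption
  show "to_complex (a * b) = to_complex a * to_complex b" using spec by (elim conjE) simp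
  show "norm (to_complex a) = norm a" using spec by (elim conjE) simp
  show "range (to_complex :: 'k \<Rightarrow> complex) = \<real> \<or> range (to_complex :: 'k \<Rightarrow> complex) = UNIV"
    using spec by (elim conjE) assumption
qed

lemma to_complex_of_real: "to_complex (of_real t) = of_real t"
  by (simp add: of_real_def to_complex_scaleR to_complex_1)

lemma to_complex_diff: "to_complex (a - b) = to_complex a - to_complex b"
  using to_complex_add[of "a - b" b] by simp

lemma to_complex_eq_iff: "to_complex a = to_complex b \<longleftrightarrow> a = b"
  using norm_to_complex[of "a - b"] by (auto simp: to_complex_diff)

lemmas to_complex_simps =
  to_complex_add to_complex_diff to_complex_mult to_complex_of_real to_complex_scaleR
  norm_to_complex

text \<open>
  Complex conjugation, or the identity for real scalars. The formula is intrinsic to \<open>'k\<close>; at \<open>0\<close> it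
  gives \<open>0\<close> by the convention for division.
\<close>

definition conj_scalar :: "'k::real_or_complex \<Rightarrow> 'k" where
  "conj_scalar a = of_real ((norm a)\<^sup>2) / a"

lemma mult_conj_scalar: "a * conj_scalar a = of_real ((norm a)\<^sup>2)"
  by (cases "a = 0") (auto simp: conj_scalar_def)

text \<open>
  Both sides have the product \<open>\<bar>a\<bar>\<^sup>2\<close> with \<open>to_complex a\<close>. The algebraic laws of \<open>conj_scalar\<close>, which are
  hard to see from its formula, are transported along this identity.
\<close>

lemma to_complex_conj: "to_complex (conj_scalar a) = cnj (to_complex a)"
proof (cases "a = 0")
  case True
  then show ?thesis using norm_to_complex[of a] by (simp add: conj_scalar_def norm_to_complex[of 0, simplified])
next
  case False
  have "to_complex a * to_complex (conj_scalar a) = to_complex a * cnj (to_complex a)"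
    by (simp only: to_complex_mult[symmetric] mult_conj_scalar to_complex_of_real
        complex_norm_square[symmetric] norm_to_complex flip: of_real_power)
  moreover have "to_complex a \<noteq> 0" using False norm_to_complex[of a] by auto
  ultimately show ?thesis by simp
qed

lemma
  fixes a b :: "'k::real_or_complex"
  shows conj_scalar_add: "conj_scalar (a + b) = conj_scalar a + conj_scalar b"
    and conj_scalar_mult: "conj_scalar (a * b) = conj_scalar a * conj_scalar b"
    and conj_conj_scalar: "conj_scalar (conj_scalar a) = a"
    and norm_conj_scalar: "norm (conj_scalar a) = norm a"
proof -
  show "conj_scalar (a + b) = conj_scalar a + conj_scalar b"
    by (rule to_complex_eq_iff[THEN iffD1]) (simp add: to_complex_conj to_complex_add)
  show "conj_scalar (a * b) = conj_scalar a * conj_scalar b"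
    by (rule to_complex_eq_iff[THEN iffD1]) (simp add: to_complex_conj to_complex_mult)
  show "conj_scalar (conj_scalar a) = a"
    by (rule to_complex_eq_iff[THEN iffD1]) (simp add: to_complex_conj)
  show "norm (conj_scalar a) = norm a"
    using norm_to_complex[of "conj_scalar a"] norm_to_complex[of a] by (simp add: to_complex_conj)
qed

lemma conj_scalar_0: "conj_scalar 0 = 0"
  by (simp add: conj_scalar_def)

lemma conj_scalar_sum: "conj_scalar (\<Sum>i\<in>A. f i) = (\<Sum>i\<in>A. conj_scalar (f i))"
  by (induction A rule: infinite_finite_induct) (auto simp: conj_scalar_0 conj_scalar_add)

section \<open>Norming functionals over the scalar field\<close>

text \<open>
  For complex scalars this is the Bohnenblust-Sobczyk formula \<open>f x = u x - \<i> u (\<i> x)\<close>.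
\<close>

lemma (in normed_space_over) functional_with_real_part:
  assumes u: "linear u"
  obtains f where "\<And>x. Re (to_complex (f x)) = u x" "\<And>x y. f (x + y) = f x + f y"
    "\<And>c x. f (smul c x) = c * f x"
proof -
  note lin = linear_add[OF u] linear_scale[OF u] linear_neg[OF u] linear_diff[OF u]
  consider "range (to_complex :: 'k \<Rightarrow> complex) = \<real>" | "range (to_complex :: 'k \<Rightarrow> complex) = UNIV"
    using range_to_complex by blast
  then show thesis
  proof cases
    case 1
    have real_scalar: "\<exists>t. c = of_real t" for c :: 'k
    proof -
      have "to_complex c \<in> \<real>" using 1 by auto
      then obtain t where "to_complex c = of_real t" by (auto elim: Reals_cases)
      then have "c = of_real t"
        using to_complex_eq_iff[of c "of_real t"] by (simp add: to_complex_of_real)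
      then show ?thesis ..
    qed
    have "of_real (u (smul c x)) = c * of_real (u x)" for c :: 'k and x
    proof -
      obtain t where "c = of_real t" using real_scalar by blast
      then show ?thesis by (simp add: smul_of_real lin)
    qed
    then show thesis
      by (intro that[of "\<lambda>x. of_real (u x)"]) (auto simp: to_complex_of_real lin)
  next
    case 2
    then obtain j :: 'k where j: "to_complex j = \<i>" by (metis UNIV_I imageE)
    define f where "f = (\<lambda>x. of_real (u x) - j * of_real (u (smul j x)))"
    have f: "to_complex (f x) = Complex (u x) (- u (smul j x))" for x
      by (simp add: f_def to_complex_simps j complex_eq_iff)
    have jj: "smul j (smul j x) = - x" for x
    proof -
      have "j * j = of_real (- 1)"
        by (rule to_complex_eq_iff[THEN iffD1])
          (simp only: to_complex_mult to_complex_of_real j, simp)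
      then show ?thesis
        using scale_scale[of j j x] smul_of_real[of "- 1" x] by (simp del: of_real_minus)
    qed
    have "f (smul c x) = c * f x" for c x
    proof -
      define s t where "s = Re (to_complex c)" and "t = Im (to_complex c)"
      have "c = of_real s + of_real t * j"
        by (rule to_complex_eq_iff[THEN iffD1])
          (simp add: to_complex_simps j s_def t_def complex_eq_iff)
      then have c: "smul c x = s *\<^sub>R x + t *\<^sub>R smul j x" for x
        by (simp add: scale_left_distrib smul_of_real flip: scale_scale)
      have "smul j (smul c x) = s *\<^sub>R smul j x - t *\<^sub>R x"
        using c[of "smul j x"] by (simp add: scale_left_commute[of j c x] jj del: scale_scale)
      then have "to_complex (f (smul c x)) = to_complex (c * f x)"
        by (simp add: to_complex_mult f c lin complex_eq_iff flip: s_def t_def)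
      then show ?thesis by (rule to_complex_eq_iff[THEN iffD1])
    qed
    moreover have "f (x + y) = f x + f y" for x y
      by (simp add: f_def lin scale_right_distrib algebra_simps)
    ultimately show thesis using f by (intro that[of f]) auto
  qed
qed

text \<open>
  The bound for the real part passes to \<open>F\<close> by rotating \<open>x\<close> until \<open>F x\<close> becomes real and nonnegative.
\<close>

lemma (in normed_space_over) norming_functional:
  obtains f where "f \<in> dual_space smul" "norm f \<le> 1" "norm (blinfun_apply f x0) \<ge> norm x0"
proof -
  obtain u where u: "linear u" "\<And>x. u x \<le> norm x" "u x0 = norm x0"
    using Hahn_Banach_sublinear[OF sublinear_norm] by metis
  obtain F where F: "\<And>x. Re (to_complex (F x)) = u x" "\<And>x y. F (x + y) = F x + F y"
    "\<And>c x. F (smul c x) = c * F x"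
    using functional_with_real_part[OF u(1)] by metis
  have le: "norm (F x) \<le> norm x" for x
  proof (cases "F x = 0")
    case False
    define c where "c = conj_scalar (F x) / of_real (norm (F x))"
    have nc: "norm c = 1" using False by (simp add: c_def norm_divide norm_conj_scalar)
    have "F (smul c x) = of_real (norm (F x))"
      using False mult_conj_scalar[of "F x"] 
      by (simp add: F c_def field_simps power2_eq_square)
    then have "norm (F x) = u (smul c x)"
      using F(1)[of "smul c x"] by (simp add: to_complex_of_real)
    also have "\<dots> \<le> norm x" using u(2)[of "smul c x"] by (simp add: norm_smul nc)
    finally show ?thesis .
  qed simp
  have "F (t *\<^sub>R x) = t *\<^sub>R F x" for t x
    using F(3)[of "of_real t" x] by (simp add: smul_of_real scaleR_conv_of_real)
  then have bl: "bounded_linear F"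
    using F(2) le by (intro bounded_linear_intro[where K=1]) auto
  let ?f = "Blinfun F"
  have app: "blinfun_apply ?f = F" by (rule bounded_linear_Blinfun_apply[OF bl])
  show thesis
  proof (rule that[of ?f])
    show "?f \<in> dual_space smul" by (simp add: dual_space_def app F)
    show "norm ?f \<le> 1" using le by (intro norm_blinfun_bound) (auto simp: app)
    have "norm x0 \<le> norm (to_complex (F x0))"
      using F(1)[of x0] u(3) complex_Re_le_cmod[of "to_complex (F x0)"] by simp
    then show "norm (blinfun_apply ?f x0) \<ge> norm x0" by (simp add: app norm_to_complex)
  qed
qed

section \<open>Orthonormal families for the Hermitian inner product\<close>

definition hdot :: "'k::real_or_complex ^ 'm \<Rightarrow> 'k ^ 'm \<Rightarrow> 'k" where
  "hdot x y = (\<Sum>i\<in>UNIV. x $ i * conj_scalar (y $ i))"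

lemma hdot_add_left: "hdot (x + y) z = hdot x z + hdot y z"
  by (simp add: hdot_def algebra_simps sum.distrib)

lemma hdot_scale_left: "hdot (c *s x) z = c * hdot x z"
  by (simp add: hdot_def algebra_simps sum_distrib_left)

lemma hdot_0_left: "hdot 0 z = 0"
  by (simp add: hdot_def)

lemma hdot_sum_left: "hdot (\<Sum>i\<in>A. f i) z = (\<Sum>i\<in>A. hdot (f i) z)"
  by (induction A rule: infinite_finite_induct) (auto simp: hdot_add_left hdot_0_left)

lemma hdot_commute: "hdot y x = conj_scalar (hdot x y)"
  by (simp add: hdot_def conj_scalar_sum conj_scalar_mult conj_conj_scalar mult.commute)

lemma hdot_self: "hdot x x = of_real ((norm x)\<^sup>2)"
  by (simp add: hdot_def mult_conj_scalar norm_vec_def L2_set_def sum_nonneg)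

lemma norm_hdot_le: "norm (hdot x y) \<le> norm x * norm y"
proof -
  have "norm (hdot x y) \<le> (\<Sum>i\<in>UNIV. \<bar>norm (x $ i)\<bar> * \<bar>norm (y $ i)\<bar>)"
    unfolding hdot_def by (rule sum_norm_le) (simp add: norm_mult norm_conj_scalar)
  also have "\<dots> \<le> norm x * norm y" unfolding norm_vec_def by (rule L2_set_mult_ineq)
  finally show ?thesis .
qed

definition orthonormal :: "('k::real_or_complex ^ 'm) set \<Rightarrow> bool" where
  "orthonormal C \<longleftrightarrow> (\<forall>x\<in>C. \<forall>y\<in>C. hdot x y = (if x = y then 1 else 0))"

lemma orthonormal_norm:
  assumes "orthonormal C" "x \<in> C"
  shows "norm x = 1"
proof -
  have "of_real ((norm x)\<^sup>2) = (1 :: 'a)" using assms hdot_self[of x] by (auto simp: orthonormal_def)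
  then have "(norm x)\<^sup>2 = 1" using of_real_eq_1_iff by blast
  then show ?thesis using norm_ge_zero[of x] by (auto simp: power2_eq_1_iff)
qed

lemma orthonormal_expansion:
  assumes "finite C" "orthonormal C" "v \<in> vec.span C"
  shows "v = (\<Sum>e\<in>C. hdot v e *s e)"
  using assms(3)
proof (induction rule: vec.span_induct_alt)
  case base
  then show ?case by (simp add: hdot_0_left)
next
  case (step c x y)
  have "(\<Sum>e\<in>C. hdot x e *s e) = (\<Sum>e\<in>C. if e = x then e else 0)"
    using assms(2) step(1) by (intro sum.cong) (auto simp: orthonormal_def)
  then have "(\<Sum>e\<in>C. hdot x e *s e) = x" using assms(1) step(1) by simp
  then have "(\<Sum>e\<in>C. (c * hdot x e) *s e) = c *s x"
    by (metis (no_types, lifting) vec.scale_scale vec.scale_sum_right sum.cong)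
  with step(2) show ?case
    by (simp add: hdot_add_left hdot_scale_left vec.scale_left_distrib sum.distrib)
qed

lemma orthonormal_parseval:
  assumes "finite C" "orthonormal C" "v \<in> vec.span C"
  shows "(norm v)\<^sup>2 = (\<Sum>e\<in>C. (norm (hdot v e))\<^sup>2)"
proof -
  have "of_real ((norm v)\<^sup>2) = hdot v v" by (simp add: hdot_self)
  also have "\<dots> = hdot (\<Sum>e\<in>C. hdot v e *s e) v"
    by (rule arg_cong[OF orthonormal_expansion[OF assms], of "\<lambda>x. hdot x v"])
  also have "\<dots> = (\<Sum>e\<in>C. hdot v e * conj_scalar (hdot v e))"
    by (simp add: hdot_sum_left hdot_scale_left flip: hdot_commute[of _ v])
  also have "\<dots> = of_real (\<Sum>e\<in>C. (norm (hdot v e))\<^sup>2)" by (simp add: mult_conj_scalar)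
  finally show ?thesis using of_real_eq_iff by blast
qed

text \<open>
  Gram-Schmidt orthonormalisation of a finite set. A vector that already lies in the span of the
  previous ones is dropped, hence only the bound on the cardinality.
\<close>

lemma gram_schmidt:
  fixes B :: "('k::real_or_complex ^ 'm) set"
  assumes "finite B"
  obtains C where "finite C" "card C \<le> card B" "orthonormal C" "B \<subseteq> vec.span C"
proof -
  have "\<exists>C. finite C \<and> card C \<le> card B \<and> orthonormal C \<and> B \<subseteq> vec.span C"
    using assms
  proof (induction B)
    case empty
    show ?case by (rule exI[of _ "{}"]) (simp add: orthonormal_def)
  next
    case (insert b B)
    then obtain C where C: "finite C" "card C \<le> card B" "orthonormal C" "B \<subseteq> vec.span C"
      by blast
    define s where "s = (\<Sum>e\<in>C. hdot b e *s e)"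
    define p where "p = b - s"
    have s: "s \<in> vec.span C"
      unfolding s_def by (intro vec.span_sum vec.span_scale vec.span_base)
    show ?case
    proof (cases "p = 0")
      case True
      then have "b \<in> vec.span C" using s by (simp add: p_def)
      then show ?thesis using C insert.hyps by (intro exI[of _ C]) auto
    next
      case False
      have sC: "hdot s e = hdot b e" if "e \<in> C" for e
      proof -
        have "hdot s e = (\<Sum>d\<in>C. if d = e then hdot b d else 0)"
          unfolding s_def hdot_sum_left hdot_scale_left
          using C(3) that by (intro sum.cong) (auto simp: orthonormal_def)
        then show ?thesis using C(1) that by simp
      qed
      have pC: "hdot p e = 0" if "e \<in> C" for e
        using hdot_add_left[of p s e] sC[OF that] by (simp add: p_def)
      define q where "q = (1 / of_real (norm p)) *s p"
      have qC: "hdot q e = 0" "hdot e q = 0" if "e \<in> C" for e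
        using pC[OF that] hdot_commute[of e q] conj_scalar_0 by (auto simp: q_def hdot_scale_left)
      have "norm q = 1"
        using False normed_space_over.norm_smul[OF normed_space_over_vec, of "1 / of_real (norm p)" p]
        by (simp add: q_def norm_divide)
      then have "hdot q q = 1" by (simp add: hdot_self)
      with C(3) qC have "orthonormal (insert q C)" by (auto simp: orthonormal_def)
      moreover have "b \<in> vec.span (insert q C)"
      proof -
        have "b = s + of_real (norm p) *s q" using False by (simp add: q_def p_def)
        moreover have "s \<in> vec.span (insert q C)" using s vec.span_mono[of C "insert q C"] by auto
        ultimately show ?thesis
          by (metis vec.span_add vec.span_scale vec.span_base insertI1)
      qed
      moreover have "B \<subseteq> vec.span (insert q C)"
        using C(4) vec.span_mono[of C "insert q C"] by auto
      moreover have "card (insert q C) \<le> card (insert b B)"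
        using C(1,2) insert.hyps by (simp add: card_insert_if)
      ultimately show ?thesis using C(1) by (intro exI[of _ "insert q C"]) auto
    qed
  qed
  then show thesis using that by blast
qed


section \<open>Tensors as operators and weak sums\<close>

text \<open>
  The supremum defining the operator norm is finite because \<open>\<parallel>T f\<parallel> \<le> \<Sum>\<^sub>k \<parallel>x\<^sub>k\<parallel> \<parallel>y\<^sub>k\<parallel>\<close> on the unit ball.
\<close>

lemma tensor_op_norm_le:
  assumes f: "f \<in> dual_space smul"
    and "norm f \<le> 1"
  shows "norm (tensor_op ((*s) :: 'k::real_or_complex \<Rightarrow> 'k ^ 'm \<Rightarrow> 'k ^ 'm) ts f)
    \<le> operator_norm_on (dual_space smul) (tensor_op (*s) ts)"
  unfolding operator_norm_on_def
proof (rule cSUP_upper)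
  show "f \<in> {u \<in> dual_space smul. norm u \<le> 1}" using assms by simp
  show "bdd_above ((\<lambda>u. norm (tensor_op (*s) ts u)) ` {u \<in> dual_space smul. norm u \<le> 1})"
  proof (rule bdd_aboveI2)
    fix u assume u: "u \<in> {u \<in> dual_space smul. norm u \<le> 1}"
    show "norm (tensor_op (*s) ts u) \<le> (\<Sum>(x, y)\<leftarrow>ts. norm x * norm y)"
      unfolding tensor_op_def
    proof (induction ts)
      case (Cons p ts)
      obtain x y where p: "p = (x, y)" by force
      have "norm (blinfun_apply u x) \<le> norm x"
        using u norm_blinfun[of u x] mult_right_mono[of "norm u" 1 "norm x"] by simp
      then have "norm (blinfun_apply u x *s y) \<le> norm x * norm y"
        using normed_space_over.norm_smul[OF normed_space_over_vec, of "blinfun_apply u x" y]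
        by (simp add: mult_right_mono)
      with Cons show ?case by (auto simp: p intro: norm_triangle_mono)
    qed simp
  qed
qed

lemma operator_norm_on_nonneg:
  "0 \<le> operator_norm_on (dual_space smul) (tensor_op ((*s) :: 'k::real_or_complex \<Rightarrow> 'k ^ 'm \<Rightarrow> 'k ^ 'm) ts)"
  using tensor_op_norm_le[of 0 smul ts] norm_ge_zero[of "tensor_op (*s) ts 0"]
  by (auto simp: dual_space_def simp del: norm_ge_zero intro: order_trans[OF norm_ge_zero])

lemma tensor_adjoint_duality:
  fixes ts :: "('x::real_normed_vector \<times> ('k::real_or_complex ^ 'm)) list"
  assumes f: "f \<in> dual_space smul" and g: "g \<in> dual_space (*s)"
  shows "blinfun_apply f (tensor_adjoint smul ts g) = blinfun_apply g (tensor_op (*s) ts f)"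
  using assms unfolding tensor_adjoint_def tensor_op_def
  by (induction ts) (auto simp: blinfun.add_right dual_space_def mult.commute)

lemma dual_unit_ball_bound:
  assumes "\<phi> \<in> dual_unit_ball smul E" "set zs \<subseteq> E"
  shows "(\<Sum>z\<leftarrow>zs. (norm (\<phi> z))\<^sup>2) \<le> (\<Sum>z\<leftarrow>zs. (norm z)\<^sup>2)"
  using assms by (intro sum_list_mono power_mono) (auto simp: dual_unit_ball_def)

lemma dual_unit_ball_0: "(\<lambda>_. 0) \<in> dual_unit_ball smul E"
  by (simp add: dual_unit_ball_def)

lemma weak_sum_upper:
  assumes "\<phi> \<in> dual_unit_ball smul E" "set zs \<subseteq> E"
  shows "(\<Sum>z\<leftarrow>zs. (norm (\<phi> z))\<^sup>2)
    \<le> (SUP \<phi>\<in>dual_unit_ball smul E. \<Sum>z\<leftarrow>zs. (norm (\<phi> z))\<^sup>2)"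
  using assms(1) dual_unit_ball_bound[OF _ assms(2)] by (intro cSUP_upper bdd_aboveI2)

text \<open>
  Vectors of the unit ball act on functionals by evaluation; these are the members of the bidual unit
  ball on which the weak sum is tested.
\<close>

lemma evaluation_in_dual_unit_ball:
  assumes "norm v \<le> 1"
  shows "(\<lambda>g. blinfun_apply g v) \<in> dual_unit_ball dual_smul E"
proof -
  have "norm (blinfun_apply g v) \<le> norm g" for g :: "'a \<Rightarrow>\<^sub>L 'b"
    using norm_blinfun[of g v] mult_left_mono[OF assms, of "norm g"] by simp
  then show ?thesis by (simp add: dual_unit_ball_def dual_smul_apply blinfun.add_left)
qed

lemma hdot_functional:
  fixes w :: "'k::real_or_complex ^ 'm"
  obtains g where "g \<in> dual_space (*s)" "norm g \<le> norm w" "\<And>x. blinfun_apply g x = hdot x w"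
proof -
  have "hdot (t *\<^sub>R x) w = t *\<^sub>R hdot x w" for t x
    using hdot_scale_left[of "of_real t" x w] normed_space_over.smul_of_real[OF normed_space_over_vec, of t x]
    by (simp add: scaleR_conv_of_real)
  then have bl: "bounded_linear (\<lambda>x. hdot x w)"
    using norm_hdot_le by (intro bounded_linear_intro[where K="norm w"]) (auto simp: hdot_add_left)
  note app = bounded_linear_Blinfun_apply[OF bl]
  show thesis
    by (rule that[of "Blinfun (\<lambda>x. hdot x w)"])
      (auto simp: app dual_space_def hdot_scale_left mult.commute norm_hdot_le intro!: norm_blinfun_bound)
qed

section \<open>The two estimates\<close>

text \<open>
  The 2-summing inequality for the single functional \<open>\<langle>\<cdot>, T f\<rangle>\<close> suffices.
\<close>

lemma operator_norm_le_2_summing_constant: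
  fixes ts :: "('x::real_normed_vector \<times> ('k::real_or_complex ^ 'm)) list"
  assumes c: "c > 0"
    and adm: "\<And>zs. set zs \<subseteq> dual_space (*s) \<Longrightarrow>
      (\<Sum>z\<leftarrow>zs. (norm (tensor_adjoint smul ts z))\<^sup>2)
        \<le> c\<^sup>2 * (SUP \<phi>\<in>dual_unit_ball dual_smul (dual_space (*s)). \<Sum>z\<leftarrow>zs. (norm (\<phi> z))\<^sup>2)"
  shows "operator_norm_on (dual_space smul) (tensor_op (*s) ts) \<le> c"
  unfolding operator_norm_on_def
proof (rule cSUP_least)
  have "0 \<in> {u \<in> dual_space smul. norm u \<le> 1}" by (simp add: dual_space_def)
  then show "{u \<in> dual_space smul. norm u \<le> 1} \<noteq> {}" by blast
  fix f assume f: "f \<in> {u \<in> dual_space smul. norm u \<le> 1}"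
  define w where "w = tensor_op (*s) ts f"
  obtain g where g: "g \<in> dual_space (*s)" "norm g \<le> norm w" "\<And>x. blinfun_apply g x = hdot x w"
    using hdot_functional by blast
  have "(norm (tensor_adjoint smul ts g))\<^sup>2
      \<le> c\<^sup>2 * (SUP \<phi>\<in>dual_unit_ball dual_smul (dual_space (*s)). \<Sum>z\<leftarrow>[g]. (norm (\<phi> z))\<^sup>2)"
    using adm[of "[g]"] g(1) by simp
  also have "\<dots> \<le> c\<^sup>2 * (norm g)\<^sup>2"
  proof (intro mult_left_mono cSUP_least)
    show "dual_unit_ball dual_smul (dual_space (*s)) \<noteq> ({} :: ((('k ^ 'm) \<Rightarrow>\<^sub>L 'k) \<Rightarrow> 'k) set)"
      using dual_unit_ball_0 by blast
    fix \<phi> :: "(('k ^ 'm) \<Rightarrow>\<^sub>L 'k) \<Rightarrow> 'k" assume "\<phi> \<in> dual_unit_ball dual_smul (dual_space (*s))"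
    then show "(\<Sum>z\<leftarrow>[g]. (norm (\<phi> z))\<^sup>2) \<le> (norm g)\<^sup>2"
      using dual_unit_ball_bound[of \<phi> dual_smul "dual_space (*s)" "[g]"] g(1) by simp
  qed simp
  finally have "norm (tensor_adjoint smul ts g) \<le> c * norm g"
    using c by (simp flip: power_mult_distrib add: power2_le_iff_abs_le)
  also have "\<dots> \<le> c * norm w" using g(2) c by simp
  finally have adj: "norm (tensor_adjoint smul ts g) \<le> c * norm w" .
  have "(norm w)\<^sup>2 = norm (hdot w w)" by (simp add: hdot_self norm_power)
  also have "\<dots> = norm (blinfun_apply f (tensor_adjoint smul ts g))"
    using tensor_adjoint_duality[of f smul g ts] f g by (simp add: w_def)
  also have "\<dots> \<le> norm f * norm (tensor_adjoint smul ts g)" by (rule norm_blinfun)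
  also have "\<dots> \<le> norm (tensor_adjoint smul ts g)" using f by (simp add: mult_left_le_one_le)
  finally have "norm w * norm w \<le> c * norm w" using adj by (simp add: power2_eq_square)
  then show "norm (tensor_op (*s) ts f) \<le> c"
    using c by (cases "w = 0") (auto simp flip: w_def)
qed

text \<open>
  A norming functional \<open>f\<close> of \<open>T\<^sup>* g\<close> turns the left-hand side into the value of \<open>g\<close> at \<open>w = T f\<close>. As \<open>w\<close>
  lies in the span of \<open>C\<close>, that value is the sum of the products \<open>\<langle>w, e\<rangle> g e\<close>; the coefficients
  of \<open>w\<close> have \<open>\<ell>\<^sub>2\<close>-norm \<open>\<parallel>w\<parallel> \<le> \<parallel>T\<parallel>\<close>.
\<close>

lemma tensor_adjoint_norm_le_orthonormal:
  fixes ts :: "('x::banach \<times> ('k::real_or_complex ^ 'm)) list"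
  assumes X: "normed_space_over smul"
    and C: "finite C" "orthonormal C" "tensor_op (*s) ts ` dual_space smul \<subseteq> vec.span C"
    and g: "g \<in> dual_space (*s)"
  shows "(norm (tensor_adjoint smul ts g))\<^sup>2
    \<le> (operator_norm_on (dual_space smul) (tensor_op (*s) ts))\<^sup>2 * (\<Sum>e\<in>C. (norm (blinfun_apply g e))\<^sup>2)"
proof -
  obtain f where f: "f \<in> dual_space smul" "norm f \<le> 1"
    and norming: "norm (tensor_adjoint smul ts g) \<le> norm (blinfun_apply f (tensor_adjoint smul ts g))"
    using normed_space_over.norming_functional[OF X] by metis
  define w where "w = tensor_op (*s) ts f"
  have w: "w \<in> vec.span C" using C(3) f(1) by (auto simp: w_def)
  have "norm (tensor_adjoint smul ts g) \<le> norm (blinfun_apply g w)"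
    using norming tensor_adjoint_duality[OF f(1) g, of ts] by (simp add: w_def)
  also have "blinfun_apply g w = (\<Sum>e\<in>C. hdot w e * blinfun_apply g e)"
    using g by (subst orthonormal_expansion[OF C(1,2) w])
      (simp add: blinfun.sum_right dual_space_def)
  also have "norm \<dots> \<le> (\<Sum>e\<in>C. \<bar>norm (hdot w e)\<bar> * \<bar>norm (blinfun_apply g e)\<bar>)"
    by (rule sum_norm_le) (simp add: norm_mult)
  also have "\<dots> \<le> L2_set (\<lambda>e. norm (hdot w e)) C * L2_set (\<lambda>e. norm (blinfun_apply g e)) C"
    by (rule L2_set_mult_ineq)
  also have "L2_set (\<lambda>e. norm (hdot w e)) C = norm w"
    by (simp add: L2_set_def flip: orthonormal_parseval[OF C(1,2) w])
  also have "norm w * L2_set (\<lambda>e. norm (blinfun_apply g e)) C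
      \<le> operator_norm_on (dual_space smul) (tensor_op (*s) ts) * L2_set (\<lambda>e. norm (blinfun_apply g e)) C"
    unfolding w_def by (intro mult_right_mono tensor_op_norm_le f L2_set_nonneg)
  finally have "(norm (tensor_adjoint smul ts g))\<^sup>2
      \<le> (operator_norm_on (dual_space smul) (tensor_op (*s) ts) * L2_set (\<lambda>e. norm (blinfun_apply g e)) C)\<^sup>2"
    by (intro power_mono) auto
  then show ?thesis by (simp add: power_mult_distrib L2_set_def sum_nonneg)
qed

text \<open>
  Summing the previous bound over \<open>zs\<close> and exchanging sums leaves one weak sum per element of an
  orthonormal family, which has at most \<open>r\<close> members.
\<close>

lemma sqrt_rank_2_summing_constant:
  fixes ts :: "('x::banach \<times> ('k::real_or_complex ^ 'm)) list"
  assumes X: "normed_space_over smul"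
    and rank: "vec.dim (tensor_op (*s) ts ` dual_space smul) \<le> r"
    and zs: "set zs \<subseteq> dual_space (*s)"
  shows "(\<Sum>z\<leftarrow>zs. (norm (tensor_adjoint smul ts z))\<^sup>2)
    \<le> (sqrt (real r) * operator_norm_on (dual_space smul) (tensor_op (*s) ts))\<^sup>2
      * (SUP \<phi>\<in>dual_unit_ball dual_smul (dual_space (*s)). \<Sum>z\<leftarrow>zs. (norm (\<phi> z))\<^sup>2)"
    (is "_ \<le> (_ * ?N)\<^sup>2 * ?W")
proof -
  obtain B where B: "vec.independent B" "tensor_op (*s) ts ` dual_space smul \<subseteq> vec.span B"
    "card B = vec.dim (tensor_op (*s) ts ` dual_space smul)"
    using vec.basis_exists by metis
  obtain C where C: "finite C" "card C \<le> card B" "orthonormal C" "B \<subseteq> vec.span C"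
    using gram_schmidt[OF vec.finiteI_independent[OF B(1)]] by metis
  have span: "tensor_op (*s) ts ` dual_space smul \<subseteq> vec.span C"
    using B(2) vec.span_minimal[OF C(4) vec.subspace_span] by blast
  have W0: "0 \<le> ?W"
    using weak_sum_upper[OF dual_unit_ball_0 zs, of dual_smul] by simp
  have "(\<Sum>z\<leftarrow>zs. (norm (tensor_adjoint smul ts z))\<^sup>2)
      \<le> (\<Sum>z\<leftarrow>zs. ?N\<^sup>2 * (\<Sum>e\<in>C. (norm (blinfun_apply z e))\<^sup>2))"
    using zs by (intro sum_list_mono tensor_adjoint_norm_le_orthonormal[OF X C(1,3) span]) auto
  also have "\<dots> = ?N\<^sup>2 * (\<Sum>e\<in>C. \<Sum>z\<leftarrow>zs. (norm (blinfun_apply z e))\<^sup>2)"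
    by (induction zs) (auto simp: sum.distrib algebra_simps)
  also have "\<dots> \<le> ?N\<^sup>2 * (\<Sum>e\<in>C. ?W)"
    using orthonormal_norm[OF C(3)] zs
    by (intro mult_left_mono sum_mono weak_sum_upper evaluation_in_dual_unit_ball) auto
  also have "\<dots> \<le> ?N\<^sup>2 * (real r * ?W)"
    using C(2) B(3) rank W0 by (intro mult_left_mono) (auto intro: mult_right_mono)
  also have "\<dots> = (sqrt (real r) * ?N)\<^sup>2 * ?W"
    by (simp add: power_mult_distrib)
  finally show ?thesis .
qed

theorem lemma3p2:
  fixes smul :: "'k::real_or_complex \<Rightarrow> 'x::banach \<Rightarrow> 'x"
    and ts :: "('x \<times> ('k ^ 'm)) list"
    and r :: nat
  assumes "normed_space_over smul"
    and "two_summing dual_smul (dual_space (*s)) (tensor_adjoint smul ts)"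
    and "vec.dim (tensor_op (*s) ts ` dual_space smul) \<le> r"
  shows "ereal (operator_norm_on (dual_space smul) (tensor_op (*s) ts))
           \<le> pi2 dual_smul (dual_space (*s)) (tensor_adjoint smul ts) \<and>
         pi2 dual_smul (dual_space (*s)) (tensor_adjoint smul ts)
           \<le> ereal (sqrt (real r) * operator_norm_on (dual_space smul) (tensor_op (*s) ts))"
    (is "ereal ?N \<le> ?P \<and> _")
proof
  show "ereal ?N \<le> ?P"
    unfolding pi2_def
    by (rule INF_greatest) (auto intro: operator_norm_le_2_summing_constant)
  have N0: "0 \<le> sqrt (real r) * ?N" by (simp add: operator_norm_on_nonneg)
  \<comment> \<open>If \<open>T = 0\<close> or \<open>r = 0\<close>, the constant \<open>sqrt r * ?N\<close> is \<open>0\<close> and so is not among the positive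
      constants of the infimum; hence the detour through \<open>\<epsilon>\<close>.\<close>
  show "?P \<le> ereal (sqrt (real r) * ?N)"
  proof (rule ereal_le_epsilon2)
    fix \<epsilon> :: real assume \<epsilon>: "0 < \<epsilon>"
    have "?P \<le> ereal (sqrt (real r) * ?N + \<epsilon>)"
      unfolding pi2_def
    proof (rule INF_lower, intro CollectI conjI allI impI)
      show "0 < sqrt (real r) * ?N + \<epsilon>" using N0 \<epsilon> by simp
      fix zs :: "(('k ^ 'm) \<Rightarrow>\<^sub>L 'k) list" assume zs: "set zs \<subseteq> dual_space (*s)"
      let ?W = "SUP \<phi>\<in>dual_unit_ball dual_smul (dual_space (*s)). \<Sum>z\<leftarrow>zs. (norm (\<phi> z))\<^sup>2"
      have "0 \<le> ?W" using weak_sum_upper[OF dual_unit_ball_0 zs, of dual_smul] by simp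
      then have "(sqrt (real r) * ?N)\<^sup>2 * ?W \<le> (sqrt (real r) * ?N + \<epsilon>)\<^sup>2 * ?W"
        using N0 \<epsilon> by (intro mult_right_mono power_mono) auto
      with sqrt_rank_2_summing_constant[OF assms(1,3) zs]
      show "(\<Sum>z\<leftarrow>zs. (norm (tensor_adjoint smul ts z))\<^sup>2) \<le> (sqrt (real r) * ?N + \<epsilon>)\<^sup>2 * ?W"
        by (rule order_trans)
    qed
    then show "?P \<le> ereal (sqrt (real r) * ?N) + ereal \<epsilon>" by simp
  qed
qed

end
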